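(* Let $L$ be a dcpo satisfying the following conditions: (1) $L$ with its Scott topology is co-sober; (2) for each $x\in L$, there exists a directed subset $D\subseteq L$ such that $x=\sup D$ and, for each $d\in D$, ${\uparrow}d$ (with the order restricted from $L$) is a quasicontinuous dcpo. Then $L$ is a $\mathcal Q_{\sigma}$-unique dcpo; that is, for every dcpo $M$, if $(\mathcal Q(L),\supseteq)$ and $(\mathcal Q(M),\supseteq)$ are order isomorphic, then $L$ and $M$ are order isomorphic.
   Context: For a poset $P$ and $A\subseteq P$, ${\uparrow}A=\{x\in P: x\ge a \text{ for some } a\in A\}$ and ${\uparrow}x={\uparrow}\{x\}$; $A$ is an upper set if $A={\uparrow}A$. A subset $D\subseteq P$ is directed if every finite subset of $D$ (including the empty one) has an upper bound in $D$. A dcpo is a poset in which every directed subset has a supremum. A subset $U\subseteq P$ is Scott open if $U={\uparrow}U$ and for every directed $D\subseteq P$ whose supremum exists, $\sup D\in U$ implies $D\cap U\ne\emptyset$; the Scott open sets form the Scott topology. $\mathcal Q(P)$ denotes the set of all compact saturated subsets of $P$ with respect to the Scott topology (saturated means upper set; compact means every open cover has a finite subcover; the empty set is included), ordered by reverse inclusion. A nonempty compact saturated subset $K$ of a space is $k$-irreducible if it cannot be written as the union of two proper compact saturated subsets (i.e. two compact saturated sets each properly contained in $K$). A space is co-sober if every $k$-irreducible compact saturated subset is the saturation of a point; for the Scott topology on $P$ this means it equals ${\uparrow}x$ for some $x\in P$. For subsets $G,H$ of a dcpo $L$, the Smyth order is $G\sqsubseteq H \iff H\subseteq{\uparrow}G$,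 and $G\ll H$ means: for every directed $D\subseteq L$, $\sup D\in{\uparrow}H$ implies $d\in{\uparrow}G$ for some $d\in D$; write $G\ll x$ for $G\ll\{x\}$. A dcpo $L$ is quasicontinuous (a quasicontinuous domain) if for each $x\in L$ the family $\mathrm{fin}(x)=\{F: F\text{ is finite},\ F\ll x\}$ is directed with respect to the Smyth order and ${\uparrow}x=\bigcap\{{\uparrow}F: F\in\mathrm{fin}(x)\}$. *)

theory Defs
  imports "HOL-Algebra.Order" "HOL-Analysis.Abstract_Topology"
begin

text \<open>Posets are records of type \<open>gorder\<close>, so that \<open>L\<lparr>carrier := A\<rparr>\<close> is the subset \<open>A\<close> with the
  order restricted from \<open>L\<close>.\<close>

definition up_closure :: "('a, 'm) gorder_scheme \<Rightarrow> 'a set \<Rightarrow> 'a set"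
  where "up_closure P A = {x \<in> carrier P. \<exists>a\<in>A. a \<sqsubseteq>\<^bsub>P\<^esub> x}"

definition upper_set :: "('a, 'm) gorder_scheme \<Rightarrow> 'a set \<Rightarrow> bool"
  where "upper_set P A \<longleftrightarrow> A = up_closure P A"

text \<open>The finite set \<open>F\<close> may be empty, so directed sets are nonempty. The relation is a parameter
  because directedness is needed both for posets and for the Smyth preorder.\<close>

definition directed_wrt :: "('a \<Rightarrow> 'a \<Rightarrow> bool) \<Rightarrow> 'a set \<Rightarrow> bool"
  where "directed_wrt r D \<longleftrightarrow> (\<forall>F. finite F \<and> F \<subseteq> D \<longrightarrow> (\<exists>u\<in>D. \<forall>x\<in>F. r x u))"

definition directed_in :: "('a, 'm) gorder_scheme \<Rightarrow> 'a set \<Rightarrow> bool"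
  where "directed_in P D \<longleftrightarrow> D \<subseteq> carrier P \<and> directed_wrt (le P) D"

locale dcpo = partial_order L for L (structure) +
  assumes directed_has_sup: "directed_in L D \<Longrightarrow> \<exists>s. is_lub L s D"

definition scott_open :: "('a, 'm) gorder_scheme \<Rightarrow> 'a set \<Rightarrow> bool"
  where "scott_open P U \<longleftrightarrow> upper_set P U \<and>
    (\<forall>D s. directed_in P D \<and> is_lub P s D \<and> s \<in> U \<longrightarrow> D \<inter> U \<noteq> {})"

definition scott_topology :: "('a, 'm) gorder_scheme \<Rightarrow> 'a topology"
  where "scott_topology P = topology (scott_open P)"

lemma upper_setD: "upper_set P U \<Longrightarrow> a \<in> U \<Longrightarrow> x \<in> carrier P \<Longrightarrow> a \<sqsubseteq>\<^bsub>P\<^esub> x \<Longrightarrow> x \<in> U"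
  unfolding upper_set_def up_closure_def by blast

lemma upper_set_subset: "upper_set P U \<Longrightarrow> U \<subseteq> carrier P"
  unfolding upper_set_def up_closure_def by blast

lemma (in partial_order) upper_setI:
  assumes "U \<subseteq> carrier L" "\<And>a x. a \<in> U \<Longrightarrow> x \<in> carrier L \<Longrightarrow> a \<sqsubseteq> x \<Longrightarrow> x \<in> U"
  shows "upper_set L U"
proof -
  have "U \<subseteq> up_closure L U"
    unfolding up_closure_def using assms(1) le_refl by blast
  moreover have "up_closure L U \<subseteq> U"
    unfolding up_closure_def using assms(2) by blast
  ultimately show ?thesis
    unfolding upper_set_def by (rule equalityI)
qed

lemma directed_inD2:
  assumes "directed_in P D" "x \<in> D" "y \<in> D"
  shows "\<exists>u\<in>D. x \<sqsubseteq>\<^bsub>P\<^esub> u \<and> y \<sqsubseteq>\<^bsub>P\<^esub> u"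
proof -
  have "finite {x, y} \<and> {x, y} \<subseteq> D" using assms by simp
  then have "\<exists>u\<in>D. \<forall>z\<in>{x, y}. z \<sqsubseteq>\<^bsub>P\<^esub> u"
    using assms(1) unfolding directed_in_def directed_wrt_def by blast
  then show ?thesis by simp
qed

lemma (in partial_order) istopology_scott_open: "istopology (scott_open L)"
  unfolding istopology_def
proof (intro conjI allI impI)
  fix U V assume UV: "scott_open L U" "scott_open L V"
  show "scott_open L (U \<inter> V)"
    unfolding scott_open_def
  proof (intro conjI allI impI)
    show "upper_set L (U \<inter> V)"
      using UV unfolding scott_open_def
      by (intro upper_setI) (auto dest: upper_setD upper_set_subset)
    fix D s assume H: "directed_in L D \<and> is_lub L s D \<and> s \<in> U \<inter> V"
    then obtain a b where ab: "a \<in> D" "a \<in> U" "b \<in> D" "b \<in> V"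
      using UV unfolding scott_open_def by blast
    then obtain u where u: "u \<in> D" "a \<sqsubseteq> u" "b \<sqsubseteq> u"
      using directed_inD2 H by metis
    moreover have "u \<in> carrier L"
      using u H unfolding directed_in_def by blast
    ultimately show "D \<inter> (U \<inter> V) \<noteq> {}"
      using ab UV unfolding scott_open_def by (blast dest: upper_setD)
  qed
next
  fix \<U> assume A: "\<forall>U\<in>\<U>. scott_open L U"
  show "scott_open L (\<Union>\<U>)"
    unfolding scott_open_def
  proof (intro conjI allI impI)
    show "upper_set L (\<Union>\<U>)"
      using A unfolding scott_open_def
      by (intro upper_setI) (auto dest: upper_setD upper_set_subset)
    fix D s assume "directed_in L D \<and> is_lub L s D \<and> s \<in> \<Union>\<U>"
    then show "D \<inter> \<Union>\<U> \<noteq> {}"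
      using A unfolding scott_open_def by blast
  qed
qed

lemma (in partial_order) openin_scott_topology: "openin (scott_topology L) U \<longleftrightarrow> scott_open L U"
  by (simp add: scott_topology_def istopology_scott_open)

lemma (in partial_order) topspace_scott_topology: "topspace (scott_topology L) = carrier L"
proof -
  have "upper_set L (carrier L)"
    by (rule upper_setI[OF subset_refl])
  moreover have "D \<inter> carrier L \<noteq> {}" if "directed_in L D" for D
  proof -
    have "D \<noteq> {}" "D \<subseteq> carrier L"
      using that unfolding directed_in_def directed_wrt_def by (metis finite.emptyI empty_iff empty_subsetI)+
    then show ?thesis by blast
  qed
  ultimately have "scott_open L (carrier L)"
    unfolding scott_open_def by metis
  moreover have "U \<subseteq> carrier L" if "scott_open L U" for U
    using that unfolding scott_open_def by (blast dest: upper_set_subset)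
  ultimately show ?thesis
    unfolding topspace_def openin_scott_topology by blast
qed

definition compact_saturated :: "('a, 'm) gorder_scheme \<Rightarrow> 'a set set"
  where "compact_saturated P = {K. compactin (scott_topology P) K \<and> upper_set P K}"

definition Q_poset :: "('a, 'm) gorder_scheme \<Rightarrow> 'a set gorder"
  where "Q_poset P = \<lparr>carrier = compact_saturated P, eq = (=), le = (\<lambda>A B. A \<supseteq> B)\<rparr>"

definition k_irreducible :: "('a, 'm) gorder_scheme \<Rightarrow> 'a set \<Rightarrow> bool"
  where "k_irreducible P K \<longleftrightarrow> K \<in> compact_saturated P \<and> K \<noteq> {} \<and>
    \<not> (\<exists>A\<in>compact_saturated P. \<exists>B\<in>compact_saturated P. A \<subset> K \<and> B \<subset> K \<and> K = A \<union> B)"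

text \<open>Co-sobriety of the Scott space of \<open>P\<close>; the saturation of a point \<open>x\<close> is the upper set it
  generates.\<close>

definition scott_co_sober :: "('a, 'm) gorder_scheme \<Rightarrow> bool"
  where "scott_co_sober P \<longleftrightarrow> (\<forall>K. k_irreducible P K \<longrightarrow> (\<exists>x\<in>carrier P. K = up_closure P {x}))"

definition smyth_le :: "('a, 'm) gorder_scheme \<Rightarrow> 'a set \<Rightarrow> 'a set \<Rightarrow> bool"
  where "smyth_le P G H \<longleftrightarrow> H \<subseteq> up_closure P G"

definition way_below :: "('a, 'm) gorder_scheme \<Rightarrow> 'a set \<Rightarrow> 'a set \<Rightarrow> bool"
  where "way_below P G H \<longleftrightarrow>
    (\<forall>D s. directed_in P D \<and> is_lub P s D \<and> s \<in> up_closure P H \<longrightarrow> (\<exists>d\<in>D. d \<in> up_closure P G))"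

definition fin_below :: "('a, 'm) gorder_scheme \<Rightarrow> 'a \<Rightarrow> 'a set set"
  where "fin_below P x = {F. F \<subseteq> carrier P \<and> finite F \<and> way_below P F {x}}"

definition quasicontinuous :: "('a, 'm) gorder_scheme \<Rightarrow> bool"
  where "quasicontinuous P \<longleftrightarrow> dcpo P \<and>
    (\<forall>x\<in>carrier P. directed_wrt (smyth_le P) (fin_below P x) \<and>
      up_closure P {x} = (\<Inter>F\<in>fin_below P x. up_closure P F))"

definition order_isomorphic :: "('a, 'm) gorder_scheme \<Rightarrow> ('b, 'n) gorder_scheme \<Rightarrow> bool"
  where "order_isomorphic P R \<longleftrightarrow> (\<exists>f. bij_betw f (carrier P) (carrier R) \<and>
    (\<forall>x\<in>carrier P. \<forall>y\<in>carrier P. x \<sqsubseteq>\<^bsub>P\<^esub> y \<longleftrightarrow> f x \<sqsubseteq>\<^bsub>R\<^esub> f y))"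

end

theory Submission
  imports Defs
begin

text \<open>Write \<open>\<up>\<close> for \<^const>\<open>up_closure\<close> and let \<open>f\<close> be an isomorphism from the compact saturated
  subsets of \<open>L\<close> to those of \<open>M\<close>. Finite unions are joins for inclusion, so being k-irreducible is a
  property of the order alone (\<open>k_irreducible_transfer\<close>). Every principal filter \<open>\<up>y\<close> of \<open>M\<close> is
  k-irreducible, hence by co-sobriety it is \<open>f (\<up>x)\<close> for a point \<open>x\<close> of \<open>L\<close>; put \<open>j y = x\<close>. This
  defines an order embedding \<open>j\<close> of \<open>M\<close> into \<open>L\<close>, and what remains is that \<open>j\<close> is onto.

  The map \<open>j\<close> preserves directed suprema, because the supremum of \<open>D\<close> can be recognised inside the
  poset of compact saturated sets: \<open>\<up>(\<Squnion>D)\<close> is the largest compact saturated set contained in all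
  \<open>\<up>d\<close>, \<open>d \<in> D\<close> (\<open>point_map_preserves_sups\<close>). So \<open>j\<close> is continuous and carries compact sets to
  compact sets. Given \<open>x\<close> in \<open>L\<close>, the set \<open>K = f (\<up>x)\<close> is compact in \<open>M\<close>, so \<open>\<up>(j ` K)\<close> is compact
  saturated in \<open>L\<close>. It lies inside \<open>\<up>x\<close>, and it contains \<open>\<up>(j k)\<close> for all \<open>k \<in> K\<close>, so that its
  image under \<open>f\<close> contains \<open>K\<close>; therefore it is all of \<open>\<up>x\<close>. In particular \<open>j k \<sqsubseteq> x\<close> for some
  \<open>k \<in> K\<close>, while \<open>x \<sqsubseteq> j k\<close> holds for all \<open>k \<in> K\<close>: the point \<open>x\<close> is in the image of \<open>j\<close>
  (\<open>point_map_surj\<close>).\<close>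

section \<open>Compact saturated sets and principal filters\<close>

lemma compact_saturated_empty: "{} \<in> compact_saturated P"
  by (simp add: compact_saturated_def upper_set_def up_closure_def)

lemma compact_saturated_Un:
  assumes "A \<in> compact_saturated P" "B \<in> compact_saturated P"
  shows "A \<union> B \<in> compact_saturated P"
proof -
  have "upper_set P (A \<union> B)"
    using assms unfolding compact_saturated_def upper_set_def up_closure_def by blast
  then show ?thesis
    using assms by (simp add: compact_saturated_def compactin_Un)
qed

lemma (in partial_order) up_closure_singleton_subset_iff:
  assumes "x \<in> carrier L" "y \<in> carrier L"
  shows "up_closure L {y} \<subseteq> up_closure L {x} \<longleftrightarrow> x \<sqsubseteq> y"
  using assms unfolding up_closure_def by (auto intro: le_trans[of x y])

lemma (in partial_order) up_closure_singleton_subset: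
  assumes "upper_set L A" "x \<in> A"
  shows "up_closure L {x} \<subseteq> A"
  using assms unfolding up_closure_def by (auto dest: upper_setD)

text \<open>Open sets are upper sets, so a set and its saturation have the same open covers.\<close>

lemma (in partial_order) up_closure_compact:
  assumes "compactin (scott_topology L) S"
  shows "up_closure L S \<in> compact_saturated L"
proof -
  have S: "S \<subseteq> carrier L"
    using compactin_subset_topspace[OF assms] topspace_scott_topology by simp
  have sub: "S \<subseteq> up_closure L S"
    using S le_refl unfolding up_closure_def by blast
  have "upper_set L (up_closure L S)"
  proof (rule upper_setI)
    show "up_closure L S \<subseteq> carrier L"
      unfolding up_closure_def by blast
    fix a x assume a: "a \<in> up_closure L S" and x: "x \<in> carrier L" "a \<sqsubseteq> x"
    then obtain b where b: "b \<in> S" "b \<sqsubseteq> a" "a \<in> carrier L"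
      unfolding up_closure_def by blast
    then have "b \<sqsubseteq> x"
      using le_trans[of b a x] x S by blast
    then show "x \<in> up_closure L S"
      using b(1) x(1) unfolding up_closure_def by blast
  qed
  moreover have "compactin (scott_topology L) (up_closure L S)"
    unfolding compactin_def
  proof (intro conjI allI impI)
    show "up_closure L S \<subseteq> topspace (scott_topology L)"
      unfolding topspace_scott_topology up_closure_def by blast
    fix \<U> assume \<U>: "Ball \<U> (openin (scott_topology L)) \<and> up_closure L S \<subseteq> \<Union>\<U>"
    then obtain \<F> where \<F>: "finite \<F>" "\<F> \<subseteq> \<U>" "S \<subseteq> \<Union>\<F>"
      using compactinD[OF assms, of \<U>] sub by blast
    have "up_closure L S \<subseteq> \<Union>\<F>"
    proof
      fix x assume "x \<in> up_closure L S"
      then obtain a where a: "a \<in> S" "x \<in> carrier L" "a \<sqsubseteq> x"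
        unfolding up_closure_def by blast
      then obtain U where U: "U \<in> \<F>" "a \<in> U"
        using \<F>(3) by blast
      then have "upper_set L U"
        using \<U> \<F>(2) unfolding openin_scott_topology scott_open_def by blast
      then show "x \<in> \<Union>\<F>"
        using upper_setD[OF _ U(2) a(2,3)] U(1) by blast
    qed
    then show "\<exists>\<F>. finite \<F> \<and> \<F> \<subseteq> \<U> \<and> up_closure L S \<subseteq> \<Union>\<F>"
      using \<F> by blast
  qed
  ultimately show ?thesis
    by (simp add: compact_saturated_def)
qed

lemma (in partial_order) up_closure_singleton_compact_saturated:
  "x \<in> carrier L \<Longrightarrow> up_closure L {x} \<in> compact_saturated L"
  by (simp add: up_closure_compact topspace_scott_topology)

text \<open>One of two sets with union \<open>\<up>x\<close> contains \<open>x\<close>, and if it is saturated it is all of \<open>\<up>x\<close>.\<close>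

lemma (in partial_order) k_irreducible_up_closure_singleton:
  assumes "x \<in> carrier L"
  shows "k_irreducible L (up_closure L {x})"
proof -
  have x: "x \<in> up_closure L {x}"
    using assms unfolding up_closure_def by auto
  have "up_closure L {x} \<subseteq> A" if "A \<in> compact_saturated L" "x \<in> A" for A
    using that up_closure_singleton_subset unfolding compact_saturated_def by blast
  then show ?thesis
    unfolding k_irreducible_def
    using x up_closure_singleton_compact_saturated[OF assms] by blast
qed

text \<open>The empty set is the least compact saturated set and \<open>A \<union> B\<close> is the least one above \<open>A\<close> and
  \<open>B\<close>, so an isomorphism respects the two notions that define k-irreducibility.\<close>

lemma k_irreducible_transfer:
  assumes bij: "bij_betw f (compact_saturated P) (compact_saturated R)"
    and iso: "\<And>A B. \<lbrakk>A \<in> compact_saturated P; B \<in> compact_saturated P\<rbrakk> \<Longrightarrow> f A \<subseteq> f B \<longleftrightarrow> A \<subseteq> B"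
    and K: "K \<in> compact_saturated P"
    and irr: "k_irreducible R (f K)"
  shows "k_irreducible P K"
proof -
  have mem: "f A \<in> compact_saturated R" if "A \<in> compact_saturated P" for A
    using bij that by (rule bij_betw_apply)
  have onto: "\<exists>A\<in>compact_saturated P. f A = C"
    if "C \<in> compact_saturated R" for C
    using bij that unfolding bij_betw_def by (metis imageE)
  have "K \<noteq> {}"
  proof
    assume "K = {}"
    then obtain A where "A \<in> compact_saturated P" "f A = {}" "K \<subseteq> A"
      using onto[OF compact_saturated_empty] by (metis empty_subsetI)
    then have "f K \<subseteq> {}"
      using iso K by blast
    then show False
      using irr unfolding k_irreducible_def by blast
  qed
  moreover have False
    if A: "A \<in> compact_saturated P" "A \<subset> K" and B: "B \<in> compact_saturated P" "B \<subset> K"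
      and AB: "K = A \<union> B" for A B
  proof -
    obtain C where C: "C \<in> compact_saturated P" "f C = f A \<union> f B"
      using onto[OF compact_saturated_Un[OF mem[OF A(1)] mem[OF B(1)]]] by blast
    then have "A \<subseteq> C" "B \<subseteq> C"
      using iso A(1) B(1) by blast+
    then have "f K \<subseteq> f A \<union> f B"
      using iso[OF K C(1)] AB C(2) by blast
    moreover have "f A \<subset> f K" "f B \<subset> f K"
      using iso[OF A(1) K] iso[OF K A(1)] iso[OF B(1) K] iso[OF K B(1)] A(2) B(2) by blast+
    ultimately have "f K = f A \<union> f B"
      by blast
    then show False
      using irr mem[OF A(1)] mem[OF B(1)] \<open>f A \<subset> f K\<close> \<open>f B \<subset> f K\<close>
      unfolding k_irreducible_def by blast
  qed
  ultimately show ?thesis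
    using K unfolding k_irreducible_def by blast
qed

section \<open>Scott continuity of maps preserving directed suprema\<close>

lemma directed_in_image:
  assumes "directed_in P D"
    and "\<And>x. x \<in> carrier P \<Longrightarrow> g x \<in> carrier R"
    and "\<And>x y. \<lbrakk>x \<in> carrier P; y \<in> carrier P; x \<sqsubseteq>\<^bsub>P\<^esub> y\<rbrakk> \<Longrightarrow> g x \<sqsubseteq>\<^bsub>R\<^esub> g y"
  shows "directed_in R (g ` D)"
proof -
  have D: "D \<subseteq> carrier P"
    using assms(1) unfolding directed_in_def by blast
  have "\<exists>u\<in>g ` D. \<forall>x\<in>F. x \<sqsubseteq>\<^bsub>R\<^esub> u" if F: "finite F" "F \<subseteq> g ` D" for F
  proof -
    obtain G where G: "finite G" "G \<subseteq> D" "F = g ` G"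
      using finite_subset_image[OF F] by blast
    then obtain u where "u \<in> D" "\<forall>x\<in>G. x \<sqsubseteq>\<^bsub>P\<^esub> u"
      using assms(1) unfolding directed_in_def directed_wrt_def by blast
    then show ?thesis
      using G D assms(3) by blast
  qed
  then show ?thesis
    using D assms(2) unfolding directed_in_def directed_wrt_def by blast
qed

lemma scott_continuous_map:
  assumes "partial_order P" "partial_order R"
    and car: "\<And>x. x \<in> carrier P \<Longrightarrow> g x \<in> carrier R"
    and mono: "\<And>x y. \<lbrakk>x \<in> carrier P; y \<in> carrier P; x \<sqsubseteq>\<^bsub>P\<^esub> y\<rbrakk> \<Longrightarrow> g x \<sqsubseteq>\<^bsub>R\<^esub> g y"
    and sup: "\<And>D s. \<lbrakk>directed_in P D; is_lub P s D\<rbrakk> \<Longrightarrow> is_lub R (g s) (g ` D)"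
  shows "continuous_map (scott_topology P) (scott_topology R) g"
proof -
  interpret P: partial_order P by fact
  interpret R: partial_order R by fact
  have "scott_open P {x \<in> carrier P. g x \<in> U}" if U: "scott_open R U" for U
    unfolding scott_open_def
  proof (intro conjI allI impI)
    have "upper_set R U"
      using U unfolding scott_open_def by blast
    then show "upper_set P {x \<in> carrier P. g x \<in> U}"
      by (intro P.upper_setI) (auto intro: upper_setD car mono)
    fix D s assume H: "directed_in P D \<and> is_lub P s D \<and> s \<in> {x \<in> carrier P. g x \<in> U}"
    then have "directed_in R (g ` D)" "is_lub R (g s) (g ` D)"
      using directed_in_image[of P D g R] car mono sup by blast+
    then have "g ` D \<inter> U \<noteq> {}"
      using U H unfolding scott_open_def by blast
    moreover have "D \<subseteq> carrier P"
      using H unfolding directed_in_def by blast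
    ultimately show "D \<inter> {x \<in> carrier P. g x \<in> U} \<noteq> {}"
      by blast
  qed
  then show ?thesis
    by (simp add: continuous_map P.topspace_scott_topology R.topspace_scott_topology
        P.openin_scott_topology R.openin_scott_topology car image_subset_iff)
qed

section \<open>The map on points induced by an isomorphism\<close>

text \<open>The results below share the following situation: the map on points that an isomorphism of
  compact saturated sets induces once principal filters correspond to principal filters. Only the
  points of \<open>M\<close> are assumed to have a partner, which is what co-sobriety of \<open>L\<close> provides.\<close>

locale compact_saturated_iso = L: dcpo L + M: dcpo M
  for L :: "('a, 'm) gorder_scheme" and M :: "('b, 'n) gorder_scheme" +
  fixes f :: "'a set \<Rightarrow> 'b set" and j :: "'b \<Rightarrow> 'a"
  assumes bij: "bij_betw f (compact_saturated L) (compact_saturated M)"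
    and iso: "\<lbrakk>A \<in> compact_saturated L; B \<in> compact_saturated L\<rbrakk> \<Longrightarrow> f A \<subseteq> f B \<longleftrightarrow> A \<subseteq> B"
    and j_carrier: "y \<in> carrier M \<Longrightarrow> j y \<in> carrier L"
    and f_j: "y \<in> carrier M \<Longrightarrow> f (up_closure L {j y}) = up_closure M {y}"
begin

lemma f_mem: "A \<in> compact_saturated L \<Longrightarrow> f A \<in> compact_saturated M"
  using bij by (rule bij_betw_apply)

text \<open>Membership of a point in a saturated set is inclusion of its principal filter, so it can be
  expressed in the order that \<open>f\<close> preserves.\<close>

lemma mem_f_iff:
  assumes "A \<in> compact_saturated L" "y \<in> carrier M"
  shows "y \<in> f A \<longleftrightarrow> j y \<in> A"
proof -
  have upper: "upper_set L A" "upper_set M (f A)"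
    using assms(1) f_mem unfolding compact_saturated_def by auto
  have "y \<in> f A \<longleftrightarrow> up_closure M {y} \<subseteq> f A"
    using M.up_closure_singleton_subset[OF upper(2)] assms(2)
    unfolding up_closure_def by auto
  also have "\<dots> \<longleftrightarrow> up_closure L {j y} \<subseteq> A"
    using iso f_j assms L.up_closure_singleton_compact_saturated j_carrier by metis
  also have "\<dots> \<longleftrightarrow> j y \<in> A"
    using L.up_closure_singleton_subset[OF upper(1)] j_carrier[OF assms(2)]
    unfolding up_closure_def by auto
  finally show ?thesis .
qed

lemma point_map_le_iff:
  assumes "x \<in> carrier M" "y \<in> carrier M"
  shows "j x \<sqsubseteq>\<^bsub>L\<^esub> j y \<longleftrightarrow> x \<sqsubseteq>\<^bsub>M\<^esub> y"
  using mem_f_iff[OF L.up_closure_singleton_compact_saturated[OF j_carrier[OF assms(1)]] assms(2)]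
    f_j[OF assms(1)] j_carrier assms
  unfolding up_closure_def by simp

text \<open>Let \<open>t\<close> be the supremum of \<open>j ` D\<close>. Since \<open>\<up>t\<close> lies in every \<open>\<up>(j d)\<close>, the set \<open>f (\<up>t)\<close> lies in
  every \<open>\<up>d\<close>, so it consists of upper bounds of \<open>D\<close> and is contained in \<open>\<up>s\<close>. Going back along \<open>f\<close>
  gives \<open>j s \<sqsubseteq> t\<close>.\<close>

lemma point_map_preserves_sups:
  assumes D: "directed_in M D" and s: "is_lub M s D"
  shows "is_lub L (j s) (j ` D)"
proof -
  have DM: "D \<subseteq> carrier M"
    using D unfolding directed_in_def by blast
  have sM: "s \<in> carrier M"
    using s unfolding least_def Upper_def by blast
  have s_ub: "d \<sqsubseteq>\<^bsub>M\<^esub> s" if "d \<in> D" for d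
    using s that DM unfolding least_def Upper_def by blast
  have "directed_in L (j ` D)"
    using directed_in_image[OF D] j_carrier point_map_le_iff by metis
  then obtain t where t: "is_lub L t (j ` D)"
    using L.directed_has_sup by blast
  have tL: "t \<in> carrier L"
    using t unfolding least_def Upper_def by blast
  have jDL: "j ` D \<subseteq> carrier L"
    using DM j_carrier by blast
  have t_ub: "j d \<sqsubseteq>\<^bsub>L\<^esub> t" if "d \<in> D" for d
    using t that jDL unfolding least_def Upper_def by blast
  note t_cs = L.up_closure_singleton_compact_saturated[OF tL]
  have "f (up_closure L {t}) \<subseteq> up_closure M {s}"
  proof
    fix y assume y: "y \<in> f (up_closure L {t})"
    then have yM: "y \<in> carrier M"
      using f_mem[OF t_cs] upper_set_subset unfolding compact_saturated_def by blast
    then have "t \<sqsubseteq>\<^bsub>L\<^esub> j y"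
      using mem_f_iff[OF t_cs] y unfolding up_closure_def by simp
    then have "d \<sqsubseteq>\<^bsub>M\<^esub> y" if "d \<in> D" for d
      using that t_ub tL yM DM j_carrier point_map_le_iff L.le_trans by (meson subsetD)
    then have "y \<in> Upper M D"
      using yM unfolding Upper_def by blast
    then have "s \<sqsubseteq>\<^bsub>M\<^esub> y"
      using s unfolding least_def by blast
    then show "y \<in> up_closure M {s}"
      using yM unfolding up_closure_def by simp
  qed
  then have "up_closure L {t} \<subseteq> up_closure L {j s}"
    using iso[OF t_cs L.up_closure_singleton_compact_saturated[OF j_carrier[OF sM]]] f_j[OF sM]
    by simp
  then have "j s \<sqsubseteq>\<^bsub>L\<^esub> t"
    using L.up_closure_singleton_subset_iff j_carrier sM tL by blast
  moreover have "t \<sqsubseteq>\<^bsub>L\<^esub> j s"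
  proof -
    have "j s \<in> Upper L (j ` D)"
      using s_ub DM sM j_carrier point_map_le_iff unfolding Upper_def by blast
    then show ?thesis
      using t unfolding least_def by blast
  qed
  ultimately have "j s = t"
    using L.le_antisym j_carrier[OF sM] tL by blast
  then show ?thesis
    using t by simp
qed

lemma point_map_continuous: "continuous_map (scott_topology M) (scott_topology L) j"
  using M.partial_order_axioms L.partial_order_axioms j_carrier point_map_le_iff
    point_map_preserves_sups
  by (intro scott_continuous_map) auto

text \<open>The image under \<open>j\<close> of the compact set \<open>K = f (\<up>x)\<close> is again compact, so \<open>\<up>(j ` K)\<close> is an
  argument of \<open>f\<close>. As its value contains \<open>K\<close>, it contains \<open>\<up>x\<close>, and so \<open>x\<close> is above a point of
  \<open>j ` K\<close>, all of which are above \<open>x\<close>.\<close>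

lemma point_map_surj:
  assumes x: "x \<in> carrier L"
  shows "x \<in> j ` carrier M"
proof -
  define K where "K = f (up_closure L {x})"
  define C where "C = up_closure L (j ` K)"
  note x_cs = L.up_closure_singleton_compact_saturated[OF x]
  have K: "compactin (scott_topology M) K" "K \<subseteq> carrier M"
    using f_mem[OF x_cs] upper_set_subset unfolding K_def compact_saturated_def by auto
  have C: "C \<in> compact_saturated L"
    unfolding C_def using image_compactin[OF K(1) point_map_continuous]
    by (rule L.up_closure_compact)
  have "K \<subseteq> f C"
  proof
    fix k assume k: "k \<in> K"
    then have "j k \<in> C"
      using K(2) j_carrier L.le_refl unfolding C_def up_closure_def by blast
    then show "k \<in> f C"
      using mem_f_iff[OF C] k K(2) by blast
  qed
  then have "up_closure L {x} \<subseteq> C"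
    using iso[OF x_cs C] unfolding K_def by simp
  then have "x \<in> C"
    using x unfolding up_closure_def by auto
  then obtain k where k: "k \<in> K" "j k \<sqsubseteq>\<^bsub>L\<^esub> x"
    unfolding C_def up_closure_def by blast
  then have "x \<sqsubseteq>\<^bsub>L\<^esub> j k"
    using mem_f_iff[OF x_cs] K(2) unfolding K_def up_closure_def by blast
  then have "x = j k"
    using k K(2) x j_carrier L.le_antisym by blast
  then show ?thesis
    using k(1) K(2) by blast
qed

lemma order_isomorphic_carriers: "order_isomorphic L M"
proof -
  have "inj_on j (carrier M)"
    by (rule inj_onI) (metis point_map_le_iff M.le_antisym M.le_refl)
  then have bij_j: "bij_betw j (carrier M) (carrier L)"
    using j_carrier point_map_surj unfolding bij_betw_def by blast
  let ?h = "inv_into (carrier M) j"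
  have "x \<sqsubseteq>\<^bsub>L\<^esub> y \<longleftrightarrow> ?h x \<sqsubseteq>\<^bsub>M\<^esub> ?h y" if "x \<in> carrier L" "y \<in> carrier L" for x y
    using that point_map_surj point_map_le_iff[of "?h x" "?h y"]
    by (simp add: f_inv_into_f inv_into_into)
  then show ?thesis
    using bij_betw_inv_into[OF bij_j] unfolding order_isomorphic_def by blast
qed

end

section \<open>Uniqueness\<close>

theorem theorem3p11:
  fixes L :: "'a gorder"
  assumes "dcpo L"
    and "scott_co_sober L"
    and "\<forall>x\<in>carrier L. \<exists>D. directed_in L D \<and> is_lub L x D \<and>
           (\<forall>d\<in>D. quasicontinuous (L\<lparr>carrier := up_closure L {d}\<rparr>))"
  shows "\<forall>M :: 'b gorder. dcpo M \<and> order_isomorphic (Q_poset L) (Q_poset M) \<longrightarrow> order_isomorphic L M"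
proof (intro allI impI, elim conjE)
  fix M :: "'b gorder"
  assume M: "dcpo M" and Q: "order_isomorphic (Q_poset L) (Q_poset M)"
  interpret L: dcpo L by fact
  interpret M: dcpo M by fact
  obtain f where bij: "bij_betw f (compact_saturated L) (compact_saturated M)"
    and iso: "\<And>A B. \<lbrakk>A \<in> compact_saturated L; B \<in> compact_saturated L\<rbrakk> \<Longrightarrow> f A \<subseteq> f B \<longleftrightarrow> A \<subseteq> B"
    using Q unfolding order_isomorphic_def Q_poset_def by auto
  have "\<exists>x\<in>carrier L. f (up_closure L {x}) = up_closure M {y}" if y: "y \<in> carrier M" for y
  proof -
    obtain K where K: "K \<in> compact_saturated L" "f K = up_closure M {y}"
      using bij M.up_closure_singleton_compact_saturated[OF y]
      unfolding bij_betw_def by (metis imageE)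
    then have "k_irreducible M (f K)"
      using M.k_irreducible_up_closure_singleton[OF y] by simp
    then have "k_irreducible L K"
      using k_irreducible_transfer[of f L M K] bij iso K(1) by blast
    then show ?thesis
      using assms(2) K(2) unfolding scott_co_sober_def by metis
  qed
  then obtain j where
    "\<And>y. y \<in> carrier M \<Longrightarrow> j y \<in> carrier L \<and> f (up_closure L {j y}) = up_closure M {y}"
    by metis
  then interpret compact_saturated_iso L M f j
    using bij iso by unfold_locales auto
  show "order_isomorphic L M"
    by (rule order_isomorphic_carriers)
qed

end
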